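(* Let $(X,\mathcal{E})$ be a connected coarsely normal coarse space, $\lambda$ the asymptotic resemblance induced by $\mathcal{E}$, and $\mathcal{B}$ the bornology induced by $\mathcal{E}$. For any subsets $A,B\subseteq X$ the following conditions are equivalent: (i) there exists $E\in\mathcal{E}$ such that $E[A]\cap B$ is unbounded; (ii) there exist an unbounded $A'\subseteq A$ and an unbounded $B'\subseteq B$ such that $A'\lambda B'$; (iii) there exists $E\in\mathcal{E}$ such that for all $D\in\mathcal{B}$, \[\bigl((A\setminus D)\times (B\setminus D)\bigr)\cap E\neq\emptyset.\] Moreover, the relation $\mathbf{b}$ on the power set of $X$ defined by letting $A\mathbf{b}B$ hold if and only if any of these equivalent conditions holds is a coarse proximity (with respect to the bornology $\mathcal{B}$).
   Context: A coarse structure on a set $X$ is a collection $\mathcal{E}$ of subsets of $X\times X$ (called controlled sets or entourages) that contains the diagonal $\triangle=\{(x,x)\mid x\in X\}$ and is closed under taking subsets, inverses $E^{-1}=\{(x,y)\mid (y,x)\in E\}$, finite unions, and compositions $E\circ F=\{(x,y)\mid \exists z\in X,\ (x,z)\in E,\ (z,y)\in F\}$. The pair $(X,\mathcal{E})$ is a coarse space. It is connected if each point of $X\times X$ belongs to some controlled set. For $A\subseteq X$ and $E\in\mathcal{E}$, $E[A]=\{x\in X\mid \exists a\in A,\ (x,a)\in E\}$. A subset $A\subseteq X$ is (coarsely) bounded if $A\times A\in\mathcal{E}$, and unbounded otherwise. A bornology on $X$ is a family $\mathcal{B}$ of subsets of $X$ containing all singletons and closed under subsets and finite (binary) unions. For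 a connected coarse space, the bounded sets form a bornology, called the bornology induced by $\mathcal{E}$. For $A,B\subseteq X$, $A\prec B$ means that for every $E\in\mathcal{E}$ there is a bounded set $K\subseteq X$ with $E[A]\subseteq B\cup K$. $(X,\mathcal{E})$ is coarsely normal if for all $A,B\subseteq X$ with $A\prec B$ there is $C\subseteq X$ with $A\prec C\prec B$. The asymptotic resemblance induced by $\mathcal{E}$ is the relation $\lambda$ on the power set of $X$ given by: $A\lambda B$ if and only if there is $E\in\mathcal{E}$ with $A\subseteq E[B]$ and $B\subseteq E[A]$. A coarse proximity on a set $X$ with bornology $\mathcal{B}$ is a relation $\mathbf{b}$ on the power set of $X$ such that for all $A,B,C\subseteq X$ (writing $\bar{\mathbf{b}}$ for the negation of $\mathbf{b}$): (a) $A\mathbf{b}B$ implies $B\mathbf{b}A$; (b) $A\mathbf{b}B$ implies $A\notin\mathcal{B}$ and $B\notin\mathcal{B}$; (c) $A\cap B\notin\mathcal{B}$ implies $A\mathbf{b}B$; (d) $(A\cup B)\mathbf{b}C$ if and only if $A\mathbf{b}C$ or $B\mathbf{b}C$; (e) $A\bar{\mathbf{b}}B$ implies that there exists $E\subseteq X$ with $A\bar{\mathbf{b}}E$ and $(X\setminus E)\bar{\mathbf{b}}B$. *)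

theory Defs
  imports Main
begin

text \<open>
  The underlying set \<open>X\<close> of every structure is an explicit carrier. Composition of entourages is
  relational composition \<open>E O F\<close> and inversion is \<open>converse\<close>; since \<open>{} \<subseteq> Id_on X\<close>, closure under
  binary unions yields closure under all finite unions.
\<close>

locale coarse_space =
  fixes X :: "'a set" and \<E> :: "('a \<times> 'a) set set"
  assumes entourage_subset: "E \<in> \<E> \<Longrightarrow> E \<subseteq> X \<times> X"
    and diagonal: "Id_on X \<in> \<E>"
    and subset_closed: "F \<in> \<E> \<Longrightarrow> E \<subseteq> F \<Longrightarrow> E \<in> \<E>"
    and converse_closed: "E \<in> \<E> \<Longrightarrow> E\<inverse> \<in> \<E>"
    and union_closed: "E \<in> \<E> \<Longrightarrow> F \<in> \<E> \<Longrightarrow> E \<union> F \<in> \<E>"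
    and comp_closed: "E \<in> \<E> \<Longrightarrow> F \<in> \<E> \<Longrightarrow> E O F \<in> \<E>"

locale connected_coarse_space = coarse_space +
  assumes connected: "p \<in> X \<times> X \<Longrightarrow> \<exists>E\<in>\<E>. p \<in> E"

text \<open>
  \<open>thicken X E A\<close> is \<open>E[A]\<close>. The set \<open>A\<close> constrains the second coordinate, so for
  \<open>E \<subseteq> X \<times> X\<close> this is \<open>E\<inverse> `` A\<close> and not \<open>E `` A\<close>.
\<close>

definition thicken :: "'a set \<Rightarrow> ('a \<times> 'a) set \<Rightarrow> 'a set \<Rightarrow> 'a set" where
  "thicken X E A = {x \<in> X. \<exists>a\<in>A. (x, a) \<in> E}"

definition coarsely_bounded :: "('a \<times> 'a) set set \<Rightarrow> 'a set \<Rightarrow> bool" where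
  "coarsely_bounded \<E> A \<longleftrightarrow> A \<times> A \<in> \<E>"

definition induced_bornology :: "'a set \<Rightarrow> ('a \<times> 'a) set set \<Rightarrow> 'a set set" where
  "induced_bornology X \<E> = {A. A \<subseteq> X \<and> coarsely_bounded \<E> A}"

definition coarse_prec :: "'a set \<Rightarrow> ('a \<times> 'a) set set \<Rightarrow> 'a set \<Rightarrow> 'a set \<Rightarrow> bool" where
  "coarse_prec X \<E> A B \<longleftrightarrow>
    (\<forall>E\<in>\<E>. \<exists>K. K \<subseteq> X \<and> coarsely_bounded \<E> K \<and> thicken X E A \<subseteq> B \<union> K)"

definition coarsely_normal :: "'a set \<Rightarrow> ('a \<times> 'a) set set \<Rightarrow> bool" where
  "coarsely_normal X \<E> \<longleftrightarrow>
    (\<forall>A B. A \<subseteq> X \<and> B \<subseteq> X \<and> coarse_prec X \<E> A B \<longrightarrow>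
      (\<exists>C. C \<subseteq> X \<and> coarse_prec X \<E> A C \<and> coarse_prec X \<E> C B))"

definition asymptotic_resemblance ::
    "'a set \<Rightarrow> ('a \<times> 'a) set set \<Rightarrow> 'a set \<Rightarrow> 'a set \<Rightarrow> bool" where
  "asymptotic_resemblance X \<E> A B \<longleftrightarrow>
    (\<exists>E\<in>\<E>. A \<subseteq> thicken X E B \<and> B \<subseteq> thicken X E A)"

locale bornology =
  fixes X :: "'a set" and \<B> :: "'a set set"
  assumes bornology_subset: "A \<in> \<B> \<Longrightarrow> A \<subseteq> X"
    and singleton_mem: "x \<in> X \<Longrightarrow> {x} \<in> \<B>"
    and bornology_subset_closed: "B \<in> \<B> \<Longrightarrow> A \<subseteq> B \<Longrightarrow> A \<in> \<B>"
    and bornology_union_closed: "A \<in> \<B> \<Longrightarrow> B \<in> \<B> \<Longrightarrow> A \<union> B \<in> \<B>"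

text \<open>
  The relation is only meaningful on subsets of \<open>X\<close>; its values on other sets are unconstrained.
\<close>

locale coarse_proximity = bornology +
  fixes b :: "'a set \<Rightarrow> 'a set \<Rightarrow> bool"
  assumes prox_sym: "A \<subseteq> X \<Longrightarrow> B \<subseteq> X \<Longrightarrow> b A B \<Longrightarrow> b B A"
    and prox_unbounded: "A \<subseteq> X \<Longrightarrow> B \<subseteq> X \<Longrightarrow> b A B \<Longrightarrow> A \<notin> \<B> \<and> B \<notin> \<B>"
    and prox_inter: "A \<subseteq> X \<Longrightarrow> B \<subseteq> X \<Longrightarrow> A \<inter> B \<notin> \<B> \<Longrightarrow> b A B"
    and prox_union: "A \<subseteq> X \<Longrightarrow> B \<subseteq> X \<Longrightarrow> C \<subseteq> X \<Longrightarrow> b (A \<union> B) C \<longleftrightarrow> b A C \<or> b B C"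
    and prox_strong: "A \<subseteq> X \<Longrightarrow> B \<subseteq> X \<Longrightarrow> \<not> b A B \<Longrightarrow>
          \<exists>E. E \<subseteq> X \<and> \<not> b A E \<and> \<not> b (X - E) B"

end

theory Submission
  imports Defs
begin

text \<open>
  The main tool is one stability fact: if \<open>K\<close> is bounded then so is \<open>E[K]\<close>, because
  \<open>E[K] \<times> E[K] \<subseteq> E \<circ> (K \<times> K) \<circ> E\<inverse>\<close>. Connectedness adds that a union of two bounded sets is
  bounded, so that removing a bounded set from an unbounded one leaves an unbounded set.

  Call \<open>A\<close> and \<open>B\<close> \<^emph>\<open>asymptotically close\<close> if \<open>E[A] \<inter> B\<close> is unbounded for some entourage
  \<open>E\<close>, which is (i). For (i) \<open>\<Rightarrow>\<close> (ii), the part of \<open>A\<close> that reaches \<open>B' = E[A] \<inter> B\<close> must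
  itself be unbounded. For (ii) \<open>\<Rightarrow>\<close> (iii), a bounded \<open>D\<close> cannot cover \<open>B'\<close> even together with
  \<open>E[D]\<close>, and a point of \<open>B' - (D \<union> E[D])\<close> is \<open>E\<close>-related only to points outside \<open>D\<close>. For
  (iii) \<open>\<Rightarrow>\<close> (i), if \<open>E\<inverse>[A] \<inter> B\<close> were bounded it could be taken as \<open>D\<close>, and it would contain the
  second coordinate of every pair in \<open>(A \<times> B) \<inter> E\<close>.

  The first four proximity axioms follow directly. For the strong axiom, \<open>A\<close> and \<open>B\<close> are not
  close iff \<open>A \<prec> X - B\<close>; a set \<open>C\<close> with \<open>A \<prec> C \<prec> X - B\<close> given by coarse normality yields
  the separating set \<open>X - C\<close>.
\<close>

section \<open>The bornology of bounded sets\<close>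

context coarse_space
begin

lemma bounded_subset_carrier: "coarsely_bounded \<E> A \<Longrightarrow> A \<subseteq> X"
  using entourage_subset unfolding coarsely_bounded_def by blast

lemma bounded_subset: "coarsely_bounded \<E> B \<Longrightarrow> A \<subseteq> B \<Longrightarrow> coarsely_bounded \<E> A"
  unfolding coarsely_bounded_def by (meson subset_closed Sigma_mono)

lemma bounded_thicken:
  assumes E: "E \<in> \<E>" and K: "coarsely_bounded \<E> K"
  shows "coarsely_bounded \<E> (thicken X E K)"
proof -
  have "thicken X E K \<times> thicken X E K \<subseteq> E O (K \<times> K) O E\<inverse>"
    unfolding thicken_def by blast
  moreover have "E O (K \<times> K) O E\<inverse> \<in> \<E>"
    using E K by (simp add: coarsely_bounded_def comp_closed converse_closed)
  ultimately show ?thesis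
    unfolding coarsely_bounded_def using subset_closed by blast
qed

end

context connected_coarse_space
begin

lemma bounded_singleton: "x \<in> X \<Longrightarrow> coarsely_bounded \<E> {x}"
  unfolding coarsely_bounded_def using diagonal subset_closed by (auto simp: Id_on_def)

lemma bounded_Un:
  assumes K: "coarsely_bounded \<E> K" and L: "coarsely_bounded \<E> L"
  shows "coarsely_bounded \<E> (K \<union> L)"
proof (cases "K = {} \<or> L = {}")
  case True
  then show ?thesis using K L by auto
next
  case False
  then obtain k l where kl: "k \<in> K" "l \<in> L" by blast
  then have "(k, l) \<in> X \<times> X"
    using bounded_subset_carrier K L by blast
  then obtain F where F: "F \<in> \<E>" "(k, l) \<in> F" using connected by blast
  have "K \<times> L \<subseteq> (K \<times> K) O F O (L \<times> L)" using kl F(2) by blast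
  moreover have "(K \<times> K) O F O (L \<times> L) \<in> \<E>"
    using K L F(1) by (simp add: coarsely_bounded_def comp_closed)
  ultimately have KL: "K \<times> L \<in> \<E>" using subset_closed by blast
  then have "L \<times> K \<in> \<E>" using converse_closed[of "K \<times> L"] by (simp add: converse_Times)
  moreover have "(K \<union> L) \<times> (K \<union> L) = (K \<times> K \<union> L \<times> L) \<union> (K \<times> L \<union> L \<times> K)" by blast
  ultimately show ?thesis
    using K L KL unfolding coarsely_bounded_def by (simp add: union_closed)
qed

lemma bornology_induced: "bornology X (induced_bornology X \<E>)"
  by unfold_locales
    (auto simp: induced_bornology_def bounded_singleton bounded_Un intro: bounded_subset)

end

section \<open>Asymptotically close sets\<close>

text \<open>
  Asymptotic closeness of \<open>A\<close> and \<open>B\<close>: some thickening of \<open>A\<close> meets \<open>B\<close> in an unbounded set.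
\<close>

definition asymptotically_close ::
    "'a set \<Rightarrow> ('a \<times> 'a) set set \<Rightarrow> 'a set \<Rightarrow> 'a set \<Rightarrow> bool" where
  "asymptotically_close X \<E> A B \<longleftrightarrow> (\<exists>E\<in>\<E>. \<not> coarsely_bounded \<E> (thicken X E A \<inter> B))"

context coarse_space
begin

lemma thicken_Int_subset: "thicken X E A \<inter> B \<subseteq> thicken X E (thicken X (E\<inverse>) B \<inter> A)"
  if "A \<subseteq> X"
  using that unfolding thicken_def by blast

text \<open>
  Thickening \<open>B\<close> back by \<open>E\<inverse>\<close> meets \<open>A\<close> in an unbounded set as soon as \<open>E[A]\<close> meets \<open>B\<close> in
  one. Both the symmetry of closeness and the passage to similar unbounded subsets rely on this.
\<close>

lemma unbounded_thicken_converse: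
  assumes "A \<subseteq> X" and "E \<in> \<E>" and "\<not> coarsely_bounded \<E> (thicken X E A \<inter> B)"
  shows "\<not> coarsely_bounded \<E> (thicken X (E\<inverse>) B \<inter> A)"
  using assms thicken_Int_subset bounded_subset bounded_thicken by meson

lemma close_imp_resembling_subsets:
  assumes A: "A \<subseteq> X" and "asymptotically_close X \<E> A B"
  obtains A' B' where "A' \<subseteq> A" "B' \<subseteq> B"
    "\<not> coarsely_bounded \<E> A'" "\<not> coarsely_bounded \<E> B'" "asymptotic_resemblance X \<E> A' B'"
proof -
  obtain E where E: "E \<in> \<E>" and unb: "\<not> coarsely_bounded \<E> (thicken X E A \<inter> B)"
    using assms(2) unfolding asymptotically_close_def by blast
  define B' where "B' = thicken X E A \<inter> B"
  define A' where "A' = thicken X (E\<inverse>) B' \<inter> A"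
  have B'_unb: "\<not> coarsely_bounded \<E> B'" using unb unfolding B'_def .
  have "thicken X E A \<inter> B' = B'" unfolding B'_def by blast
  then have A'_unb: "\<not> coarsely_bounded \<E> A'"
    using unbounded_thicken_converse[OF A E, of B'] B'_unb unfolding A'_def by simp
  have "B' \<subseteq> thicken X (E \<union> E\<inverse>) A'" "A' \<subseteq> thicken X (E \<union> E\<inverse>) B'"
    using A unfolding A'_def B'_def thicken_def by blast+
  then have "asymptotic_resemblance X \<E> A' B'"
    unfolding asymptotic_resemblance_def using E union_closed converse_closed by blast
  moreover have "A' \<subseteq> A" "B' \<subseteq> B" unfolding A'_def B'_def by blast+
  ultimately show thesis using that A'_unb B'_unb by simp
qed

lemma meets_outside_bounded_imp_close:
  assumes E: "E \<in> \<E>"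
    and meets: "\<And>D. D \<in> induced_bornology X \<E> \<Longrightarrow> ((A - D) \<times> (B - D)) \<inter> E \<noteq> {}"
  shows "asymptotically_close X \<E> A B"
proof (rule ccontr)
  assume "\<not> asymptotically_close X \<E> A B"
  define D where "D = thicken X (E\<inverse>) A \<inter> B"
  have "D \<in> induced_bornology X \<E>"
    using \<open>\<not> asymptotically_close X \<E> A B\<close> converse_closed[OF E]
    unfolding D_def asymptotically_close_def induced_bornology_def thicken_def by auto
  then obtain a b where "a \<in> A" "b \<in> B" "b \<notin> D" "(a, b) \<in> E"
    using meets by blast
  moreover have "b \<in> X" using entourage_subset[OF E] \<open>(a, b) \<in> E\<close> by blast
  ultimately show False unfolding D_def thicken_def by blast
qed

lemma close_commute:
  "A \<subseteq> X \<Longrightarrow> asymptotically_close X \<E> A B \<Longrightarrow> asymptotically_close X \<E> B A"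
  unfolding asymptotically_close_def using unbounded_thicken_converse converse_closed by meson

lemma close_imp_unbounded:
  assumes "asymptotically_close X \<E> A B"
  shows "\<not> coarsely_bounded \<E> A" and "\<not> coarsely_bounded \<E> B"
  using assms unfolding asymptotically_close_def
  by (meson bounded_thicken bounded_subset inf_le1 inf_le2)+

lemma unbounded_Int_imp_close:
  assumes "A \<subseteq> X" and "\<not> coarsely_bounded \<E> (A \<inter> B)"
  shows "asymptotically_close X \<E> A B"
proof -
  have "thicken X (Id_on X) A = A" using assms(1) unfolding thicken_def by auto
  then show ?thesis
    unfolding asymptotically_close_def using assms(2) diagonal by metis
qed

end

context connected_coarse_space
begin

lemma resembling_subsets_imp_meets_outside_bounded:
  assumes "A' \<subseteq> A" and "B' \<subseteq> B" and unb: "\<not> coarsely_bounded \<E> B'"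
    and res: "asymptotic_resemblance X \<E> A' B'"
  obtains E where "E \<in> \<E>" and
    "\<And>D. D \<in> induced_bornology X \<E> \<Longrightarrow> ((A - D) \<times> (B - D)) \<inter> E \<noteq> {}"
proof -
  obtain E where E: "E \<in> \<E>" and cover: "B' \<subseteq> thicken X E A'"
    using res unfolding asymptotic_resemblance_def by blast
  \<comment> \<open>A point \<open>y\<close> of \<open>E[A']\<close> pairs with \<open>x \<in> A'\<close> as \<open>(y, x) \<in> E\<close>, hence the converse.\<close>
  have "((A - D) \<times> (B - D)) \<inter> E\<inverse> \<noteq> {}" if "D \<in> induced_bornology X \<E>" for D
  proof -
    have "coarsely_bounded \<E> D" using that unfolding induced_bornology_def by blast
    then have "coarsely_bounded \<E> (D \<union> thicken X E D)"
      using bounded_Un bounded_thicken E by blast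
    then obtain y where y: "y \<in> B'" "y \<notin> D" "y \<notin> thicken X E D"
      using unb bounded_subset by blast
    then obtain x where "x \<in> A'" "(y, x) \<in> E" "y \<in> X"
      using cover unfolding thicken_def by blast
    moreover have "x \<notin> D" using y(3) calculation unfolding thicken_def by blast
    ultimately show ?thesis using y assms(1,2) by blast
  qed
  then show thesis using that converse_closed[OF E] by blast
qed

lemma close_Un_left:
  "asymptotically_close X \<E> (A \<union> B) C \<longleftrightarrow>
    asymptotically_close X \<E> A C \<or> asymptotically_close X \<E> B C"
proof -
  have "thicken X E (A \<union> B) \<inter> C = (thicken X E A \<inter> C) \<union> (thicken X E B \<inter> C)" for E
    unfolding thicken_def by blast
  then have "coarsely_bounded \<E> (thicken X E (A \<union> B) \<inter> C) \<longleftrightarrow>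
      coarsely_bounded \<E> (thicken X E A \<inter> C) \<and> coarsely_bounded \<E> (thicken X E B \<inter> C)" for E
    using bounded_Un bounded_subset by (metis Un_upper1 Un_upper2)
  then show ?thesis unfolding asymptotically_close_def by blast
qed

end

section \<open>Separation from coarse normality\<close>

context coarse_space
begin

text \<open>
  The bounded error \<open>K\<close> in \<open>A \<prec> C\<close> can always be taken to be \<open>E[A] - C\<close>.
\<close>

lemma coarse_prec_iff_not_close:
  "coarse_prec X \<E> A C \<longleftrightarrow> \<not> asymptotically_close X \<E> A (X - C)"
proof
  assume "coarse_prec X \<E> A C"
  moreover have "thicken X E A \<inter> (X - C) \<subseteq> K" if "thicken X E A \<subseteq> C \<union> K" for E K
    using that by blast
  ultimately show "\<not> asymptotically_close X \<E> A (X - C)"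
    unfolding coarse_prec_def asymptotically_close_def by (meson bounded_subset)
next
  assume "\<not> asymptotically_close X \<E> A (X - C)"
  moreover have "thicken X E A \<subseteq> C \<union> (thicken X E A \<inter> (X - C))" for E
    unfolding thicken_def by blast
  ultimately show "coarse_prec X \<E> A C"
    unfolding coarse_prec_def asymptotically_close_def by (meson bounded_subset_carrier)
qed

lemma not_close_separation:
  assumes normal: "coarsely_normal X \<E>" and A: "A \<subseteq> X" and B: "B \<subseteq> X"
    and "\<not> asymptotically_close X \<E> A B"
  obtains S where "S \<subseteq> X"
    "\<not> asymptotically_close X \<E> A S" "\<not> asymptotically_close X \<E> (X - S) B"
proof -
  have "coarse_prec X \<E> A (X - B)"
    using assms by (simp add: coarse_prec_iff_not_close double_diff)
  then obtain C where C: "C \<subseteq> X" "coarse_prec X \<E> A C" "coarse_prec X \<E> C (X - B)"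
    using normal A unfolding coarsely_normal_def by (meson Diff_subset)
  show thesis
  proof
    show "X - C \<subseteq> X" by blast
    show "\<not> asymptotically_close X \<E> A (X - C)"
      using C(2) by (simp add: coarse_prec_iff_not_close)
    show "\<not> asymptotically_close X \<E> (X - (X - C)) B"
      using C(1,3) B by (simp add: coarse_prec_iff_not_close double_diff)
  qed
qed

end

lemma (in connected_coarse_space) coarse_proximity_close:
  assumes normal: "coarsely_normal X \<E>"
    and b: "\<And>A B. A \<subseteq> X \<Longrightarrow> B \<subseteq> X \<Longrightarrow> b A B \<longleftrightarrow> asymptotically_close X \<E> A B"
  shows "coarse_proximity X (induced_bornology X \<E>) b"
proof (rule coarse_proximity.intro[OF bornology_induced], unfold_locales)
  fix A B assume A: "A \<subseteq> X" and B: "B \<subseteq> X"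
  show "b B A" if "b A B"
    using that A B close_commute by (simp add: b)
  show "A \<notin> induced_bornology X \<E> \<and> B \<notin> induced_bornology X \<E>" if "b A B"
    using that A B close_imp_unbounded by (auto simp: b induced_bornology_def)
  show "b A B" if "A \<inter> B \<notin> induced_bornology X \<E>"
    using that A B unbounded_Int_imp_close by (auto simp: b induced_bornology_def)
  show "b (A \<union> B) C \<longleftrightarrow> b A C \<or> b B C" if "C \<subseteq> X" for C
    using that A B by (simp add: b close_Un_left)
  show "\<exists>S. S \<subseteq> X \<and> \<not> b A S \<and> \<not> b (X - S) B" if "\<not> b A B"
    using not_close_separation[OF normal A B] that A B b by (metis Diff_subset)
qed

section \<open>The equivalence and the induced coarse proximity\<close>

theorem corollary4p2:
  fixes X :: "'a set" and \<E> :: "('a \<times> 'a) set set"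
  assumes "connected_coarse_space X \<E>"
    and "coarsely_normal X \<E>"
  shows
    "(\<forall>A B. A \<subseteq> X \<and> B \<subseteq> X \<longrightarrow>
        ((\<exists>E\<in>\<E>. \<not> coarsely_bounded \<E> (thicken X E A \<inter> B)) \<longleftrightarrow>
         (\<exists>A' B'. A' \<subseteq> A \<and> B' \<subseteq> B \<and>
            \<not> coarsely_bounded \<E> A' \<and> \<not> coarsely_bounded \<E> B' \<and>
            asymptotic_resemblance X \<E> A' B')) \<and>
        ((\<exists>A' B'. A' \<subseteq> A \<and> B' \<subseteq> B \<and>
            \<not> coarsely_bounded \<E> A' \<and> \<not> coarsely_bounded \<E> B' \<and>
            asymptotic_resemblance X \<E> A' B') \<longleftrightarrow>
         (\<exists>E\<in>\<E>. \<forall>D\<in>induced_bornology X \<E>. ((A - D) \<times> (B - D)) \<inter> E \<noteq> {}))) \<and>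
     (\<forall>b. (\<forall>A B. A \<subseteq> X \<and> B \<subseteq> X \<longrightarrow>
              (b A B \<longleftrightarrow> (\<exists>E\<in>\<E>. \<not> coarsely_bounded \<E> (thicken X E A \<inter> B)))) \<longrightarrow>
          coarse_proximity X (induced_bornology X \<E>) b)"
proof -
  interpret connected_coarse_space X \<E> by fact
  show ?thesis
    unfolding asymptotically_close_def[symmetric]
  proof (intro conjI allI impI; (elim conjE)?)
    fix A B assume A: "A \<subseteq> X" and B: "B \<subseteq> X"
    let ?res = "\<exists>A' B'. A' \<subseteq> A \<and> B' \<subseteq> B \<and>
      \<not> coarsely_bounded \<E> A' \<and> \<not> coarsely_bounded \<E> B' \<and> asymptotic_resemblance X \<E> A' B'"
    let ?meets = "\<exists>E\<in>\<E>. \<forall>D\<in>induced_bornology X \<E>. ((A - D) \<times> (B - D)) \<inter> E \<noteq> {}"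
    have 1: ?res if "asymptotically_close X \<E> A B"
      by (rule close_imp_resembling_subsets[OF A that]) blast
    have 2: ?meets if ?res
    proof -
      obtain A' B' where "A' \<subseteq> A" "B' \<subseteq> B" "\<not> coarsely_bounded \<E> B'"
        "asymptotic_resemblance X \<E> A' B'"
        using \<open>?res\<close> by blast
      then show ?meets
        by (rule resembling_subsets_imp_meets_outside_bounded) blast
    qed
    have 3: "asymptotically_close X \<E> A B" if ?meets
      using that meets_outside_bounded_imp_close by blast
    show "asymptotically_close X \<E> A B \<longleftrightarrow> ?res" using 1 2 3 by argo
    show "?res \<longleftrightarrow> ?meets" using 1 2 3 by argo
  next
    fix b assume "\<forall>A B. A \<subseteq> X \<and> B \<subseteq> X \<longrightarrow> (b A B \<longleftrightarrow> asymptotically_close X \<E> A B)"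
    then show "coarse_proximity X (induced_bornology X \<E>) b"
      by (intro coarse_proximity_close[OF assms(2)]) simp
  qed
qed

end
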